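(* Let $K\ge1$ be an integer with $K\equiv\pm1\pmod6$, and let $p_1,\dots,p_r$ be the distinct primes dividing $K^2+4$. For every integer $m>1$ there exists $N$ such that for all $n\ge N$, $\pi_K^n(m)=24\cdot p_1^{j_1}\cdots p_r^{j_r}$ for some integers $j_1,\dots,j_r\ge0$.
   Context: The $K$-Fibonacci sequence is $F_{K,0}=0$, $F_{K,1}=1$, $F_{K,n}=K F_{K,n-1}+F_{K,n-2}$; for an integer $m>1$, $\pi_K(m)$ is the length of its shortest period modulo $m$; iterates are $\pi_K^1=\pi_K$ and $\pi_K^{n+1}(m)=\pi_K(\pi_K^n(m))$. *)

theory Defs
  imports "HOL-Number_Theory.Number_Theory"
begin

fun kfib :: "nat \<Rightarrow> nat \<Rightarrow> nat" where
  "kfib K 0 = 0"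
| "kfib K (Suc 0) = 1"
| "kfib K (Suc (Suc n)) = K * kfib K (Suc n) + kfib K n"

definition kfib_period :: "nat \<Rightarrow> nat \<Rightarrow> nat" where
  "kfib_period K m = (LEAST t. t > 0 \<and> (\<forall>n. [kfib K (n + t) = kfib K n] (mod m)))"

end

theory Submission
  imports Defs
begin

text \<open>
  Let \<open>F\<close> be the \<open>K\<close>-Fibonacci sequence, \<open>\<pi> m\<close> its period modulo \<open>m\<close> and \<open>D = K\<^sup>2 + 4\<close>. Expanding Binet's
  formula gives \<open>F p \<equiv> D ^ ((p - 1) / 2)\<close> modulo an odd prime \<open>p\<close>. Hence \<open>p\<close> divides \<open>F p\<close> if \<open>p\<close> divides \<open>D\<close>;
  otherwise it divides \<open>(F p)\<^sup>2 - 1\<close>, which is \<open>F (p - 1) * F (p + 1)\<close> by Cassini's identity. As \<open>m dvd F t\<close>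
  makes \<open>4 t\<close> a period modulo \<open>m\<close>, and already \<open>2 t\<close> if \<open>t\<close> is even, \<open>\<pi> p\<close> divides \<open>4 p\<close> in the first
  case and \<open>p\<^sup>2 - 1\<close> in the second; the latter also holds for \<open>p = 2\<close>. Passing from \<open>p ^ k\<close> to
  \<open>p ^ (k + 1)\<close> multiplies the period by at most \<open>p\<close>.

  Now \<open>p\<^sup>2 - 1\<close> divides \<open>24\<close> for \<open>p = 2\<close> and \<open>p = 3\<close>, and has only prime factors below \<open>p\<close> for \<open>p > 3\<close>. Consider
  the primes not dividing \<open>D\<close> whose exponent in \<open>m\<close> exceeds that in \<open>24\<close>. The largest of them loses an
  exponent at every step and only smaller ones can appear, so they all vanish after finitely many steps.
  Conversely, Cassini's identity makes \<open>\<pi> m\<close> even for \<open>m > 2\<close>, and together with \<open>\<pi> 2 = 3\<close> and \<open>\<pi> 3 = 8\<close> this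
  forces \<open>24\<close> to divide all late iterates.
\<close>

section \<open>Primes and multiplicities\<close>

lemma square_minus_1_nat: "(n :: nat)\<^sup>2 - 1 = (n - 1) * (n + 1)"
  by (simp add: power2_eq_square algebra_simps)

lemma not_dvd_square_minus_1:
  fixes p :: nat
  assumes "p > 1"
  shows "\<not> p dvd p\<^sup>2 - 1"
proof
  assume "p dvd p\<^sup>2 - 1"
  moreover have "p\<^sup>2 = (p\<^sup>2 - 1) + 1"
    using assms by simp
  ultimately have "p dvd 1"
    by (metis dvd_add_right_iff dvd_power pos2)
  then show False
    using assms by simp
qed

lemma prime_dvd_square_minus_1_less:
  fixes p q :: nat
  assumes "prime p" "p > 2" "prime q" "q dvd p\<^sup>2 - 1"
  shows "q < p"
proof -
  consider "q dvd p - 1" | "q dvd p + 1"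
    using assms(3,4) unfolding square_minus_1_nat by (auto simp only: prime_dvd_mult_iff)
  then show ?thesis
  proof cases
    case 1
    then show ?thesis
      using dvd_imp_le[OF 1] \<open>p > 2\<close> by simp
  next
    case 2
    have "\<not> prime (p + 1)"
      using prime_odd_nat[of "p + 1"] prime_odd_nat[of p] assms by auto
    then have "q \<noteq> p + 1"
      using \<open>prime q\<close> by blast
    moreover have "q \<noteq> p"
      using assms(2,4) not_dvd_square_minus_1[of p] by auto
    moreover have "q \<le> p + 1"
      using 2 by (rule dvd_imp_le) simp
    ultimately show ?thesis
      by linarith
  qed
qed

lemma not_3_dvd_square_plus_4:
  fixes K :: nat
  shows "\<not> 3 dvd K\<^sup>2 + 4"
proof -
  have "K mod 3 = 0 \<or> K mod 3 = 1 \<or> K mod 3 = 2"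
    by presburger
  then have "K\<^sup>2 mod 3 = 0 \<or> K\<^sup>2 mod 3 = 1"
    using power_mod[of K 3 2] by auto
  then show ?thesis
    by presburger
qed

lemma prime_power_Suc_eq_of_dvd:
  fixes p :: nat
  assumes "prime p" "d dvd p ^ Suc n" "\<not> d dvd p ^ n"
  shows "d = p ^ Suc n"
  using assms by (metis divides_primepow_nat le_Suc_eq)

lemma multiplicity_24_eq_0:
  fixes p :: nat
  assumes "prime p" "p > 3"
  shows "multiplicity p 24 = 0"
proof -
  have "\<not> p dvd 2" "\<not> p dvd 3"
    using \<open>p > 3\<close> by (auto dest: dvd_imp_le)
  then have "\<not> p dvd 2 ^ 3 * 3"
    using \<open>prime p\<close> by (metis prime_dvd_mult_iff prime_dvd_power)
  then show ?thesis
    by (simp add: not_dvd_imp_multiplicity_0)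
qed

lemma multiplicity_Lcm_attained:
  fixes A :: "'a :: factorial_semiring_gcd set"
  assumes "finite A" "A \<noteq> {}" "0 \<notin> A" "prime q"
  shows "\<exists>a\<in>A. multiplicity q (Lcm A) = multiplicity q a"
  using assms(1-3)
proof (induction A rule: finite_ne_induct)
  case (insert a A)
  then have "a \<noteq> 0" "Lcm A \<noteq> 0"
    by (auto simp: Lcm_0_iff)
  then have "multiplicity q (Lcm (insert a A)) = max (multiplicity q a) (multiplicity q (Lcm A))"
    using \<open>prime q\<close> by (simp add: multiplicity_lcm)
  then show ?case
    using insert by (auto simp: max_def)
qed simp

lemma prod_multiplicity_superset:
  fixes x :: "'a :: factorial_semiring_multiplicative"
  assumes "x \<noteq> 0" "finite A" "prime_factors x \<subseteq> A" "\<And>p. p \<in> A \<Longrightarrow> prime p"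
  shows "(\<Prod>p\<in>A. p ^ multiplicity p x) = normalize x"
proof -
  have "(\<Prod>p\<in>prime_factors x. p ^ multiplicity p x) = (\<Prod>p\<in>A. p ^ multiplicity p x)"
    using assms by (intro prod.mono_neutral_left) (auto simp: prime_factors_multiplicity)
  then show ?thesis
    using prod_prime_factors[OF \<open>x \<noteq> 0\<close>] by simp
qed

section \<open>Identities for the sequence\<close>

lemma kfib_add:
  "kfib K (m + n) + K * kfib K m * kfib K n = kfib K m * kfib K (Suc n) + kfib K (Suc m) * kfib K n"
proof (induction m rule: induct_nat_012)
  case (ge2 m)
  have "kfib K (Suc (Suc m) + n) + K * kfib K (Suc (Suc m)) * kfib K n
      = K * (kfib K (Suc m + n) + K * kfib K (Suc m) * kfib K n)
        + (kfib K (m + n) + K * kfib K m * kfib K n)"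
    by (simp add: algebra_simps)
  then show ?case
    unfolding ge2.IH by (simp add: algebra_simps)
qed simp_all

lemma kfib_cassini:
  "int (kfib K (Suc n)) ^ 2 - int (kfib K n) * int (kfib K (Suc (Suc n))) = (- 1) ^ n"
proof (induction n)
  case (Suc n)
  have "int (kfib K (Suc (Suc n))) ^ 2 - int (kfib K (Suc n)) * int (kfib K (Suc (Suc (Suc n))))
      = - (int (kfib K (Suc n)) ^ 2 - int (kfib K n) * int (kfib K (Suc (Suc n))))"
    by (simp add: power2_eq_square algebra_simps)
  then show ?case
    unfolding Suc by simp
qed simp

lemma kfib_binet:
  fixes s :: "'a :: comm_ring_1"
  assumes "s\<^sup>2 = of_nat (K\<^sup>2 + 4)"
  shows "2 ^ n * of_nat (kfib K n) * s = (of_nat K + s) ^ n - (of_nat K - s) ^ n"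
proof (induction n rule: induct_nat_012)
  case (ge2 n)
  have root: "x ^ Suc (Suc n) = 2 * of_nat K * x ^ Suc n + 4 * x ^ n"
    if "x\<^sup>2 = 2 * of_nat K * x + 4" for x :: 'a
    using arg_cong[OF that, of "\<lambda>y. y * x ^ n"] by (simp add: power2_eq_square algebra_simps)
  have "2 ^ Suc (Suc n) * of_nat (kfib K (Suc (Suc n))) * s
      = 2 * of_nat K * (2 ^ Suc n * of_nat (kfib K (Suc n)) * s)
        + 4 * (2 ^ n * of_nat (kfib K n) * s)"
    by (simp add: algebra_simps)
  also have "\<dots> = (2 * of_nat K * (of_nat K + s) ^ Suc n + 4 * (of_nat K + s) ^ n)
      - (2 * of_nat K * (of_nat K - s) ^ Suc n + 4 * (of_nat K - s) ^ n)"
    unfolding ge2.IH by (simp add: algebra_simps)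
  also have "\<dots> = (of_nat K + s) ^ Suc (Suc n) - (of_nat K - s) ^ Suc (Suc n)"
    using assms by (subst (1 2) root) (simp_all add: power2_eq_square algebra_simps)
  finally show ?case .
qed (simp_all add: algebra_simps)

lemma kfib_binomial_sum:
  "2 ^ n * kfib K n = 2 * (\<Sum>k | k \<le> n \<and> odd k. (n choose k) * K ^ (n - k) * (K\<^sup>2 + 4) ^ (k div 2))"
proof -
  define s where "s = sqrt (real (K\<^sup>2 + 4))"
  let ?c = "\<lambda>k. (n choose k) * K ^ (n - k)"
  have s: "s\<^sup>2 = real (K\<^sup>2 + 4)" "s \<noteq> 0"
    unfolding s_def by (simp_all add: add_nonneg_eq_0_iff)
  have odd_sum: "(\<Sum>k\<le>n. if odd k then f k else 0) = (\<Sum>k | k \<le> n \<and> odd k. f k)" for f :: "nat \<Rightarrow> real"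
    using sum.inter_filter[of "{..n}" f odd] by simp
  have odd_power: "s ^ k = real ((K\<^sup>2 + 4) ^ (k div 2)) * s" if "odd k" for k
  proof -
    obtain i where "k = 2 * i + 1"
      using \<open>odd k\<close> by (elim oddE)
    then show ?thesis
      using s(1) by (simp add: power_mult)
  qed
  have "real (2 ^ n * kfib K n) * s = (s + real K) ^ n - (- s + real K) ^ n"
    using kfib_binet[OF s(1), of n] by (simp add: add.commute)
  also have "\<dots> = (\<Sum>k\<le>n. real (?c k) * (s ^ k - (- s) ^ k))"
    unfolding binomial_ring by (simp add: algebra_simps flip: sum_subtractf)
  also have "\<dots> = (\<Sum>k\<le>n. if odd k then real (2 * (?c k * (K\<^sup>2 + 4) ^ (k div 2))) * s else 0)"
    by (intro sum.cong) (simp_all add: odd_power)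
  also have "\<dots> = real (2 * (\<Sum>k | k \<le> n \<and> odd k. ?c k * (K\<^sup>2 + 4) ^ (k div 2))) * s"
    unfolding odd_sum by (simp add: sum_distrib_left sum_distrib_right)
  finally show ?thesis
    unfolding mult_right_cancel[OF s(2)] of_nat_eq_iff .
qed

lemma kfib_prime_cong:
  assumes "prime p" "odd p"
  shows "[kfib K p = (K\<^sup>2 + 4) ^ (p div 2)] (mod p)"
proof -
  let ?D = "K\<^sup>2 + 4"
  let ?f = "\<lambda>k. (p choose k) * K ^ (p - k) * ?D ^ (k div 2)"
  have coprime: "coprime 2 p" and not_dvd: "\<not> p dvd 2"
    using assms primes_dvd_imp_eq[OF _ two_is_prime_nat] by auto
  have "{k. k \<le> p \<and> odd k} = insert p {k. k < p \<and> odd k}"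
    using \<open>odd p\<close> by auto
  then have sum_eq: "2 ^ p * kfib K p = 2 * (?D ^ (p div 2) + (\<Sum>k | k < p \<and> odd k. ?f k))"
    by (simp add: kfib_binomial_sum)
  have "p dvd (\<Sum>k | k < p \<and> odd k. ?f k)"
    using assms dvd_choose_prime[of _ p] by (auto intro!: dvd_sum dvd_mult2 odd_pos)
  then have "[2 ^ p * kfib K p = 2 * (?D ^ (p div 2) + 0)] (mod p)"
    unfolding sum_eq by (intro cong_scalar_left cong_add cong_refl) (simp only: cong_0_iff)
  moreover have "2 ^ p * kfib K p = 2 * (2 ^ (p - 1) * kfib K p)"
    using prime_gt_0_nat[OF \<open>prime p\<close>] by (simp flip: power_Suc mult.assoc)
  ultimately have "[2 * (2 ^ (p - 1) * kfib K p) = 2 * (?D ^ (p div 2) + 0)] (mod p)"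
    by (simp only:)
  then have "[2 ^ (p - 1) * kfib K p = ?D ^ (p div 2)] (mod p)"
    using coprime by (simp only: cong_mult_lcancel_nat add_0_right)
  moreover have "[2 ^ (p - 1) * kfib K p = 1 * kfib K p] (mod p)"
    by (intro cong_scalar_right fermat_theorem \<open>prime p\<close> not_dvd)
  ultimately show ?thesis
    by (metis cong_sym cong_trans mult_1)
qed

section \<open>Periods\<close>

definition is_kfib_period :: "nat \<Rightarrow> nat \<Rightarrow> nat \<Rightarrow> bool" where
  "is_kfib_period K m t \<longleftrightarrow> (\<forall>n. [kfib K (n + t) = kfib K n] (mod m))"

lemma kfib_shift_cong:
  assumes "m dvd kfib K t"
  shows "[kfib K (n + t) = kfib K n * kfib K (Suc t)] (mod m)"
proof -
  have "m dvd K * kfib K n * kfib K t" "m dvd kfib K (Suc n) * kfib K t"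
    using assms by simp_all
  then have "[kfib K (n + t) + K * kfib K n * kfib K t = kfib K (n + t) + 0] (mod m)"
    "[kfib K n * kfib K (Suc t) + kfib K (Suc n) * kfib K t = kfib K n * kfib K (Suc t) + 0] (mod m)"
    by (intro cong_add cong_refl; simp add: cong_0_iff)+
  then show ?thesis
    unfolding kfib_add by (metis add_0_right cong_sym cong_trans)
qed

lemma is_kfib_period_iff:
  "is_kfib_period K m t \<longleftrightarrow> m dvd kfib K t \<and> [kfib K (Suc t) = 1] (mod m)"
proof
  assume "is_kfib_period K m t"
  then have "[kfib K (0 + t) = kfib K 0] (mod m)" "[kfib K (1 + t) = kfib K 1] (mod m)"
    unfolding is_kfib_period_def by blast+
  then show "m dvd kfib K t \<and> [kfib K (Suc t) = 1] (mod m)"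
    by (simp add: cong_0_iff)
next
  assume start: "m dvd kfib K t \<and> [kfib K (Suc t) = 1] (mod m)"
  then have "[kfib K n * kfib K (Suc t) = kfib K n * 1] (mod m)" for n
    by (intro cong_scalar_left) blast
  then show "is_kfib_period K m t"
    unfolding is_kfib_period_def using start kfib_shift_cong cong_trans by (metis mult_1_right)
qed

lemma is_kfib_period_mult:
  assumes "is_kfib_period K m t"
  shows "is_kfib_period K m (k * t)"
proof (induction k)
  case (Suc k)
  have "[kfib K (n + k * t + t) = kfib K n] (mod m)" for n
    using assms Suc unfolding is_kfib_period_def by (blast intro: cong_trans)
  then show ?case
    unfolding is_kfib_period_def by (simp add: ac_simps)
qed (simp add: is_kfib_period_def)

lemma is_kfib_period_mod:
  assumes "is_kfib_period K m s" "is_kfib_period K m t"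
  shows "is_kfib_period K m (t mod s)"
  unfolding is_kfib_period_def
proof
  fix n
  have "is_kfib_period K m (t div s * s)"
    using assms(1) by (rule is_kfib_period_mult)
  then have "[kfib K (n + t mod s + t div s * s) = kfib K (n + t mod s)] (mod m)"
    unfolding is_kfib_period_def by blast
  moreover have "n + t mod s + t div s * s = n + t"
    by simp
  moreover have "[kfib K (n + t) = kfib K n] (mod m)"
    using assms(2) unfolding is_kfib_period_def by blast
  ultimately show "[kfib K (n + t mod s) = kfib K n] (mod m)"
    by (metis cong_sym cong_trans)
qed

lemma is_kfib_period_dvd_trans:
  "is_kfib_period K m s \<Longrightarrow> s dvd t \<Longrightarrow> is_kfib_period K m t"
  by (metis dvdE is_kfib_period_mult mult.commute)

lemma is_kfib_period_dvd_modulus: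
  "is_kfib_period K m t \<Longrightarrow> d dvd m \<Longrightarrow> is_kfib_period K d t"
  unfolding is_kfib_period_def by (blast intro: cong_dvd_modulus_nat)

lemma is_kfib_period_double:
  assumes "m dvd kfib K t" "even t"
  shows "is_kfib_period K m (2 * t)"
proof -
  have "int m dvd int (kfib K t) * int (kfib K (Suc (Suc t)))"
    using assms(1) by simp
  then have "[int (kfib K (Suc t) ^ 2) = int 1] (mod int m)"
    using kfib_cassini[of K t] \<open>even t\<close> by (simp add: cong_iff_dvd_diff algebra_simps)
  then have "[kfib K (Suc t) ^ 2 = 1] (mod m)"
    by (simp only: cong_int_iff)
  moreover have "[kfib K (Suc t + t) = kfib K (Suc t) ^ 2] (mod m)"
    using kfib_shift_cong[OF assms(1), of "Suc t"] by (simp add: power2_eq_square)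
  moreover have "[kfib K (t + t) = kfib K t * kfib K (Suc t)] (mod m)"
    by (rule kfib_shift_cong[OF assms(1)])
  ultimately show ?thesis
    unfolding is_kfib_period_iff using assms(1)
    by (simp add: mult_2 cong_dvd_iff) (metis cong_trans)
qed

lemma is_kfib_period_quadruple:
  assumes "m dvd kfib K t"
  shows "is_kfib_period K m (4 * t)"
proof -
  have "m dvd kfib K (2 * t)"
    using kfib_shift_cong[OF assms, of t] assms by (simp add: mult_2 cong_dvd_iff)
  then show ?thesis
    using is_kfib_period_double[of m K "2 * t"] by simp
qed

lemma kfib_add_multiple_cong:
  assumes "is_kfib_period K m t"
  shows "[int (kfib K (n + k * t)) = kfib K n + k * (int (kfib K (n + t)) - kfib K n)]
    (mod (int m)\<^sup>2)"
proof (induction k arbitrary: n)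
  case (Suc k)
  define \<Delta> where "\<Delta> n = int (kfib K (n + t)) - kfib K n" for n
  have m_dvd: "int m dvd \<Delta> n" for n
    using assms unfolding is_kfib_period_def \<Delta>_def by (metis cong_iff_dvd_diff cong_int_iff)
  have \<Delta>_eq: "\<Delta> n = int (kfib K n) * \<Delta> 1 + (int (kfib K (Suc n)) - K * int (kfib K n)) * \<Delta> 0" for n
    using arg_cong[OF kfib_add[of K n t], of int] unfolding \<Delta>_def by (simp add: algebra_simps)
  \<comment> \<open>With \<open>S\<close> the shift by one, \<open>\<Delta>\<close> is \<open>(S ^ t - 1) F\<close>, and \<open>S ^ t - 1\<close> is divisible by \<open>m\<close>, so its square by \<open>m\<^sup>2\<close>.\<close>
  have "\<Delta> (n + t) - \<Delta> n = \<Delta> n * \<Delta> 1 + (\<Delta> (Suc n) - K * \<Delta> n) * \<Delta> 0"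
    unfolding \<Delta>_eq[of "n + t"] by (subst \<Delta>_eq[of n]) (simp add: \<Delta>_def algebra_simps)
  then have "(int m)\<^sup>2 dvd \<Delta> (n + t) - \<Delta> n"
    unfolding power2_eq_square by (simp only:) (intro dvd_add mult_dvd_mono dvd_diff dvd_mult m_dvd)
  then have "[int (kfib K (n + t)) + k * \<Delta> (n + t) = int (kfib K (n + t)) + k * \<Delta> n] (mod (int m)\<^sup>2)"
    by (intro cong_add cong_scalar_left cong_refl) (simp add: cong_iff_dvd_diff)
  with Suc[of "n + t"] have
    "[int (kfib K (n + t + k * t)) = int (kfib K (n + t)) + k * \<Delta> n] (mod (int m)\<^sup>2)"
    unfolding \<Delta>_def by (rule cong_trans)
  then show ?case
    unfolding \<Delta>_def by (simp add: algebra_simps)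
qed simp

lemma is_kfib_period_mult_modulus:
  assumes "is_kfib_period K m t" "p dvd m"
  shows "is_kfib_period K (m * p) (p * t)"
  unfolding is_kfib_period_def
proof
  fix n
  have "[int (kfib K (n + t)) = kfib K n] (mod int m)"
    using assms(1) unfolding is_kfib_period_def cong_int_iff by blast
  then have "int (m * p) dvd p * (int (kfib K (n + t)) - kfib K n)"
    by (simp add: cong_iff_dvd_diff mult.commute)
  then have "[kfib K n + p * (int (kfib K (n + t)) - kfib K n) = int (kfib K n) + 0] (mod int (m * p))"
    by (intro cong_add cong_refl) (simp only: cong_0_iff)
  moreover have "int (m * p) dvd (int m)\<^sup>2"
    using assms(2) by (simp add: power2_eq_square)
  then have "[int (kfib K (n + p * t)) = kfib K n + p * (int (kfib K (n + t)) - kfib K n)] (mod int (m * p))"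
    using kfib_add_multiple_cong[OF assms(1)] cong_dvd_modulus by blast
  ultimately show "[kfib K (n + p * t) = kfib K n] (mod m * p)"
    by (metis add_0_right cong_int_iff cong_trans)
qed

lemma is_kfib_period_prime_power:
  assumes "is_kfib_period K p t"
  shows "is_kfib_period K (p ^ Suc k) (t * p ^ k)"
proof (induction k)
  case (Suc k)
  then have "is_kfib_period K (p ^ Suc k * p) (p * (t * p ^ k))"
    by (rule is_kfib_period_mult_modulus) simp
  then show ?case
    by (simp add: ac_simps)
qed (simp add: assms)

definition prime_period_multiple :: "nat \<Rightarrow> nat \<Rightarrow> nat" where
  "prime_period_multiple K p = (if p dvd K\<^sup>2 + 4 then 4 * p else p\<^sup>2 - 1)"

lemma prime_dvd_kfib_self:
  assumes "prime p" "p dvd K\<^sup>2 + 4"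
  shows "p dvd kfib K p"
proof (cases "p = 2")
  case True
  moreover have "kfib K 2 = K"
    by (simp add: numeral_2_eq_2)
  ultimately show ?thesis
    using assms(2) by simp
next
  case False
  then have "odd p" "p div 2 > 0"
    using \<open>prime p\<close> prime_odd_nat[of p] prime_ge_2_nat[of p] by auto
  then show ?thesis
    using kfib_prime_cong[OF \<open>prime p\<close>, of K] assms by (simp add: cong_dvd_iff prime_dvd_power_iff)
qed

lemma prime_dvd_kfib_pred_or_Suc:
  assumes "prime p" "odd p" "\<not> p dvd K\<^sup>2 + 4"
  shows "p dvd kfib K (p - 1) \<or> p dvd kfib K (p + 1)"
proof -
  have "p > 0" using \<open>odd p\<close> by (rule odd_pos)
  have "[kfib K p ^ 2 = ((K\<^sup>2 + 4) ^ (p div 2)) ^ 2] (mod p)"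
    using assms by (intro cong_pow kfib_prime_cong)
  also have "((K\<^sup>2 + 4) ^ (p div 2)) ^ 2 = (K\<^sup>2 + 4) ^ (p - 1)"
    using \<open>odd p\<close> by (simp add: mult.commute flip: power_mult)
  also have "[\<dots> = 1] (mod p)"
    using assms by (intro fermat_theorem)
  finally have "int p dvd int (kfib K p) ^ 2 - 1"
    by (metis cong_iff_dvd_diff cong_int_iff of_nat_1 of_nat_power)
  also have "int (kfib K p) ^ 2 - 1 = int (kfib K (p - 1) * kfib K (p + 1))"
    using kfib_cassini[of K "p - 1"] \<open>odd p\<close> \<open>p > 0\<close> by (simp add: algebra_simps)
  finally show ?thesis
    using \<open>prime p\<close> by (simp only: of_nat_dvd_iff prime_dvd_mult_iff)
qed

lemma is_kfib_period_2_3: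
  assumes "odd K"
  shows "is_kfib_period K 2 3"
proof -
  have "kfib K 3 = K * K + 1" "kfib K (Suc 3) = K * (K * K + 1) + K"
    by (simp_all add: eval_nat_numeral)
  then have "even (kfib K 3)" "odd (kfib K (Suc 3))"
    using assms by simp_all
  then show ?thesis
    unfolding is_kfib_period_iff by (simp only: cong_def odd_iff_mod_2_eq_one) simp
qed

lemma is_kfib_period_prime_period_multiple:
  assumes "prime p"
  shows "is_kfib_period K p (prime_period_multiple K p)"
proof -
  consider "p dvd K\<^sup>2 + 4" | "p = 2" "odd K" | "odd p" "\<not> p dvd K\<^sup>2 + 4"
    using prime_odd_nat[OF assms] prime_ge_2_nat[OF assms] by fastforce
  then show ?thesis
  proof cases
    case 1
    then show ?thesis
      using assms by (simp add: prime_period_multiple_def is_kfib_period_quadruple prime_dvd_kfib_self)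
  next
    case 2
    then show ?thesis
      using is_kfib_period_2_3 by (simp add: prime_period_multiple_def)
  next
    case 3
    then have even: "even (p - 1)" "even (p + 1)"
      by simp_all
    from prime_dvd_kfib_pred_or_Suc[OF assms 3] have "is_kfib_period K p ((p - 1) * (p + 1))"
    proof
      assume "p dvd kfib K (p - 1)"
      then have "is_kfib_period K p (2 * (p - 1))"
        using even(1) by (rule is_kfib_period_double)
      then show ?thesis
        by (rule is_kfib_period_dvd_trans) (metis even(2) mult.commute mult_dvd_mono dvd_refl)
    next
      assume "p dvd kfib K (p + 1)"
      then have "is_kfib_period K p (2 * (p + 1))"
        using even(2) by (rule is_kfib_period_double)
      then show ?thesis
        by (rule is_kfib_period_dvd_trans) (intro mult_dvd_mono even(1) dvd_refl)
    qed
    then show ?thesis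
      using 3(2) by (simp only: prime_period_multiple_def if_False square_minus_1_nat)
  qed
qed

lemma is_kfib_period_prime_factors:
  assumes "m > 0" "\<And>p. p \<in> prime_factors m \<Longrightarrow> is_kfib_period K (p ^ multiplicity p m) t"
  shows "is_kfib_period K m t"
proof -
  have "[kfib K (n + t) = kfib K n] (mod \<Prod>p\<in>prime_factors m. p ^ multiplicity p m)" for n
    using assms(2) unfolding is_kfib_period_def
    by (intro coprime_cong_prod_nat) (auto intro: primes_coprime)
  then show ?thesis
    unfolding is_kfib_period_def using prime_factorization_nat[OF \<open>m > 0\<close>] by simp
qed

definition period_multiples :: "nat \<Rightarrow> nat \<Rightarrow> nat set" where
  "period_multiples K m =
    (\<lambda>p. prime_period_multiple K p * p ^ (multiplicity p m - 1)) ` prime_factors m"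

lemma is_kfib_period_Lcm:
  assumes "m > 0"
  shows "is_kfib_period K m (Lcm (period_multiples K m))"
proof (rule is_kfib_period_prime_factors[OF assms])
  fix p assume p: "p \<in> prime_factors m"
  let ?k = "multiplicity p m - 1"
  have "is_kfib_period K (p ^ Suc ?k) (prime_period_multiple K p * p ^ ?k)"
    using p by (intro is_kfib_period_prime_power is_kfib_period_prime_period_multiple) auto
  moreover have "prime_period_multiple K p * p ^ ?k dvd Lcm (period_multiples K m)"
    using p unfolding period_multiples_def by (intro dvd_Lcm imageI)
  moreover have "Suc ?k = multiplicity p m"
    using p by (simp add: prime_factors_multiplicity)
  ultimately show "is_kfib_period K (p ^ multiplicity p m) (Lcm (period_multiples K m))"
    by (metis is_kfib_period_dvd_trans)
qed

lemma prime_period_multiple_pos: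
  assumes "prime p"
  shows "prime_period_multiple K p > 0"
  using prime_gt_1_nat[OF assms] one_less_power[of p 2]
  by (simp add: prime_period_multiple_def del: One_nat_def)

lemma zero_not_in_period_multiples: "0 \<notin> period_multiples K m"
proof
  assume "0 \<in> period_multiples K m"
  then obtain p where "prime p" "prime_period_multiple K p = 0"
    by (auto simp: period_multiples_def in_prime_factors_iff)
  then show False
    using prime_period_multiple_pos[of p K] by simp
qed

lemma finite_period_multiples: "finite (period_multiples K m)"
  by (simp add: period_multiples_def)

lemma Lcm_period_multiples_nonzero: "Lcm (period_multiples K m) \<noteq> 0"
  using finite_period_multiples zero_not_in_period_multiples by (simp only: Lcm_0_iff) simp

section \<open>The shortest period\<close>

lemma kfib_period_eq_Least: "kfib_period K m = (LEAST t. t > 0 \<and> is_kfib_period K m t)"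
  unfolding kfib_period_def is_kfib_period_def ..

lemma
  assumes "m > 0"
  shows kfib_period_pos: "kfib_period K m > 0"
    and is_kfib_period_kfib_period: "is_kfib_period K m (kfib_period K m)"
proof -
  have "Lcm (period_multiples K m) > 0 \<and> is_kfib_period K m (Lcm (period_multiples K m))"
    using is_kfib_period_Lcm[OF assms] Lcm_period_multiples_nonzero by blast
  then have "kfib_period K m > 0 \<and> is_kfib_period K m (kfib_period K m)"
    unfolding kfib_period_eq_Least by (rule LeastI)
  then show "kfib_period K m > 0" "is_kfib_period K m (kfib_period K m)"
    by simp_all
qed

lemma kfib_period_dvd_iff:
  assumes "m > 0"
  shows "kfib_period K m dvd t \<longleftrightarrow> is_kfib_period K m t"
proof
  assume "kfib_period K m dvd t"
  then show "is_kfib_period K m t"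
    using is_kfib_period_kfib_period[OF assms] is_kfib_period_dvd_trans by blast
next
  assume "is_kfib_period K m t"
  then have "is_kfib_period K m (t mod kfib_period K m)"
    using is_kfib_period_kfib_period[OF assms] is_kfib_period_mod by blast
  moreover have "t mod kfib_period K m < kfib_period K m"
    using kfib_period_pos[OF assms] by simp
  then have "\<not> (t mod kfib_period K m > 0 \<and> is_kfib_period K m (t mod kfib_period K m))"
    unfolding kfib_period_eq_Least by (rule not_less_Least)
  ultimately have "t mod kfib_period K m = 0"
    by (metis neq0_conv)
  then show "kfib_period K m dvd t"
    by (rule mod_eq_0_iff_dvd[THEN iffD1])
qed

lemma kfib_period_dvd_mono:
  assumes "d dvd m" "m > 0"
  shows "kfib_period K d dvd kfib_period K m"
proof -
  have "is_kfib_period K d (kfib_period K m)"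
    by (rule is_kfib_period_dvd_modulus[OF is_kfib_period_kfib_period[OF \<open>m > 0\<close>] \<open>d dvd m\<close>])
  then show ?thesis
    unfolding kfib_period_dvd_iff[OF dvd_pos_nat[OF \<open>m > 0\<close> \<open>d dvd m\<close>]] .
qed

lemma kfib_period_gt_1:
  assumes "m > 1"
  shows "kfib_period K m > 1"
proof -
  have "m > 0"
    using assms by simp
  have "kfib_period K m \<noteq> 1"
  proof
    assume "kfib_period K m = 1"
    then have "m dvd kfib K 1"
      using is_kfib_period_kfib_period[OF \<open>m > 0\<close>] unfolding is_kfib_period_iff by metis
    then show False
      using assms by simp
  qed
  then show ?thesis
    using kfib_period_pos[OF \<open>m > 0\<close>, of K] by linarith
qed

lemma even_kfib_period:
  assumes "m > 2"
  shows "even (kfib_period K m)"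
proof (rule ccontr)
  define t where "t = kfib_period K m"
  assume "odd (kfib_period K m)"
  then have "odd t"
    by (simp add: t_def)
  have "m dvd kfib K t" "[kfib K (Suc t) = 1] (mod m)"
    using is_kfib_period_kfib_period[of m K] assms by (simp_all add: t_def is_kfib_period_iff)
  then have "[int (kfib K t) = 0] (mod int m)" "[int (kfib K (Suc t)) = int 1] (mod int m)"
    by (simp_all only: cong_0_iff cong_int_iff of_nat_dvd_iff)
  then have "[int (kfib K (Suc t)) ^ 2 - int (kfib K t) * int (kfib K (Suc (Suc t)))
      = int 1 ^ 2 - 0 * int (kfib K (Suc (Suc t)))] (mod int m)"
    by (intro cong_diff cong_pow cong_scalar_right)
  then have "[- 1 = 1] (mod int m)"
    unfolding kfib_cassini using \<open>odd t\<close> by simp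
  then have "int m dvd 2"
    by (simp add: cong_iff_dvd_diff)
  then show False
    using assms zdvd_imp_le[of "int m" 2] by simp
qed

lemma multiplicity_kfib_period_le:
  assumes "m > 1" "prime q"
  shows "\<exists>p\<in>prime_factors m.
    multiplicity q (kfib_period K m)
      \<le> multiplicity q (prime_period_multiple K p * p ^ (multiplicity p m - 1))"
proof -
  let ?A = "period_multiples K m"
  have "kfib_period K m dvd Lcm ?A"
    using assms by (simp add: kfib_period_dvd_iff is_kfib_period_Lcm)
  then have "multiplicity q (kfib_period K m) \<le> multiplicity q (Lcm ?A)"
    using Lcm_period_multiples_nonzero by (rule dvd_imp_multiplicity_le)
  moreover have "prime_factors m \<noteq> {}"
    using assms by (simp add: prime_factorization_empty_iff)
  then have "?A \<noteq> {}"
    by (simp add: period_multiples_def)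
  then obtain a where "a \<in> ?A" "multiplicity q (Lcm ?A) = multiplicity q a"
    using multiplicity_Lcm_attained finite_period_multiples zero_not_in_period_multiples assms by metis
  ultimately show ?thesis
    by (auto simp: period_multiples_def)
qed

section \<open>Descent of the excess primes\<close>

definition excess_primes :: "nat \<Rightarrow> nat \<Rightarrow> nat set" where
  "excess_primes K m =
    {q. prime q \<and> \<not> q dvd K\<^sup>2 + 4 \<and> multiplicity q 24 < multiplicity q m}"

lemma finite_excess_primes: "finite (excess_primes K m)"
proof (rule finite_subset)
  show "excess_primes K m \<subseteq> prime_factors m"
    by (auto simp: excess_primes_def prime_factors_multiplicity)
qed simp

lemma multiplicity_prime_period_multiple_gt_24D:
  assumes "prime p" "prime q" "q \<noteq> p"
    and "multiplicity q 24 < multiplicity q (prime_period_multiple K p)"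
  shows "q < p \<and> 3 < p \<and> \<not> p dvd K\<^sup>2 + 4"
proof -
  have not_dvd_24: "\<not> prime_period_multiple K p dvd 24"
    using assms(4) dvd_imp_multiplicity_le[of _ 24 q] by (metis linorder_not_less zero_neq_numeral)
  have unramified: "\<not> p dvd K\<^sup>2 + 4"
  proof
    assume "p dvd K\<^sup>2 + 4"
    then have "multiplicity q (prime_period_multiple K p) = multiplicity q (4 * p)"
      by (simp add: prime_period_multiple_def)
    also have "\<dots> = multiplicity q 4 + multiplicity q p"
      using assms(1,2) by (intro prime_elem_multiplicity_mult_distrib) auto
    also have "multiplicity q p = 0"
      using assms(1-3) by (simp add: prime_multiplicity_other)
    also have "multiplicity q 4 + 0 \<le> multiplicity q 24"
      unfolding add_0_right
      by (rule dvd_imp_multiplicity_le) simp_all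
    finally show False
      using assms(4) by simp
  qed
  then have "p \<noteq> 2" "p \<noteq> 3"
    using not_dvd_24 by (auto simp: prime_period_multiple_def)
  then have "p > 3"
    using prime_ge_2_nat[OF \<open>prime p\<close>] by simp
  moreover have "q dvd p\<^sup>2 - 1"
    using assms(4) unramified not_dvd_imp_multiplicity_0[of q "p\<^sup>2 - 1"]
    by (auto simp: prime_period_multiple_def)
  then have "q < p"
    using \<open>p > 3\<close> by (intro prime_dvd_square_minus_1_less[OF \<open>prime p\<close> _ \<open>prime q\<close>]) linarith+
  ultimately show ?thesis
    using unramified by blast
qed

lemma excess_primes_kfib_period_descent:
  assumes "m > 1" "q \<in> excess_primes K (kfib_period K m)"
  shows "multiplicity q (kfib_period K m) < multiplicity q m \<or> (\<exists>p\<in>excess_primes K m. q < p)"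
proof -
  have q: "prime q" "\<not> q dvd K\<^sup>2 + 4" "multiplicity q 24 < multiplicity q (kfib_period K m)"
    using assms(2) by (auto simp: excess_primes_def)
  obtain p where p: "prime p" "p dvd m" and multiplicity_le:
    "multiplicity q (kfib_period K m)
      \<le> multiplicity q (prime_period_multiple K p * p ^ (multiplicity p m - 1))"
    using multiplicity_kfib_period_le[OF \<open>m > 1\<close> \<open>prime q\<close>, of K] by auto
  have multiplicity_mult: "multiplicity q (prime_period_multiple K p * p ^ (multiplicity p m - 1))
      = multiplicity q (prime_period_multiple K p) + multiplicity q (p ^ (multiplicity p m - 1))"
    using q(1) p(1) prime_period_multiple_pos[of p K]
    by (intro prime_elem_multiplicity_mult_distrib) auto
  have multiplicity_pos: "multiplicity p m > 0"
    using p \<open>m > 1\<close> by (simp add: prime_multiplicity_gt_zero_iff)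
  show ?thesis
  proof (cases "q = p")
    case True
    then have "multiplicity q (prime_period_multiple K p) = 0"
      using q not_dvd_square_minus_1[of q] prime_gt_1_nat[of q]
      by (simp add: prime_period_multiple_def not_dvd_imp_multiplicity_0)
    then have "multiplicity q (kfib_period K m) \<le> multiplicity q m - 1"
      using multiplicity_le multiplicity_mult True q(1) by simp
    then have "multiplicity q (kfib_period K m) < multiplicity q m"
      using multiplicity_pos unfolding \<open>q = p\<close> by linarith
    then show ?thesis ..
  next
    case False
    then have "multiplicity q 24 < multiplicity q (prime_period_multiple K p)"
      using q multiplicity_le multiplicity_mult p(1) by (simp add: multiplicity_distinct_prime_power)
    from multiplicity_prime_period_multiple_gt_24D[OF p(1) q(1) False this]
    have "q < p" "p > 3" "\<not> p dvd K\<^sup>2 + 4"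
      by blast+
    then have "p \<in> excess_primes K m"
      using p(1) multiplicity_pos multiplicity_24_eq_0[of p] by (simp add: excess_primes_def)
    then show ?thesis
      using \<open>q < p\<close> by blast
  qed
qed

lemma excess_primes_empty_kfib_period:
  assumes "m > 1" "excess_primes K m = {}"
  shows "excess_primes K (kfib_period K m) = {}"
proof -
  have "q \<in> excess_primes K m \<or> (\<exists>p\<in>excess_primes K m. q < p)"
    if "q \<in> excess_primes K (kfib_period K m)" for q
    using excess_primes_kfib_period_descent[OF \<open>m > 1\<close> that] that by (auto simp: excess_primes_def)
  then show ?thesis
    using assms(2) by blast
qed

definition excess_rank :: "nat \<Rightarrow> nat \<Rightarrow> nat \<times> nat" where
  "excess_rank K m = (Max (excess_primes K m), multiplicity (Max (excess_primes K m)) m)"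

lemma excess_rank_kfib_period_less:
  assumes "m > 1" "excess_primes K (kfib_period K m) \<noteq> {}"
  shows "(excess_rank K (kfib_period K m), excess_rank K m) \<in> less_than <*lex*> less_than"
proof -
  define q where "q = Max (excess_primes K (kfib_period K m))"
  define M where "M = Max (excess_primes K m)"
  have q: "q \<in> excess_primes K (kfib_period K m)"
    unfolding q_def using finite_excess_primes assms(2) by (rule Max_in)
  have M_ge: "p \<le> M" if "p \<in> excess_primes K m" for p
    unfolding M_def using finite_excess_primes that by (rule Max_ge)
  from excess_primes_kfib_period_descent[OF \<open>m > 1\<close> q]
  have "q < M \<or> q = M \<and> multiplicity q (kfib_period K m) < multiplicity q m"
  proof
    assume decrease: "multiplicity q (kfib_period K m) < multiplicity q m"
    then have "q \<in> excess_primes K m"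
      using q by (auto simp: excess_primes_def)
    then show ?thesis
      using decrease M_ge le_neq_implies_less by blast
  next
    assume "\<exists>p\<in>excess_primes K m. q < p"
    then show ?thesis
      using M_ge less_le_trans by blast
  qed
  then show ?thesis
    by (auto simp: excess_rank_def simp flip: q_def M_def)
qed

lemma reaches_no_excess_primes:
  assumes "m > 1"
  shows "\<exists>n. excess_primes K ((kfib_period K ^^ n) m) = {}"
  using assms
proof (induction "excess_rank K m" arbitrary: m
    rule: wf_induct_rule[OF wf_lex_prod[OF wf_less_than wf_less_than], case_names less])
  case (less m)
  show ?case
  proof (cases "excess_primes K (kfib_period K m) = {}")
    case True
    then show ?thesis
      by (intro exI[of _ 1]) simp
  next
    case False
    then obtain n where "excess_primes K ((kfib_period K ^^ n) (kfib_period K m)) = {}"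
      using less excess_rank_kfib_period_less kfib_period_gt_1 by blast
    then show ?thesis
      by (intro exI[of _ "Suc n"]) (simp only: funpow_Suc_right o_apply)
  qed
qed

section \<open>Divisibility of the iterates by 24\<close>

lemma three_dvd_kfib_period:
  assumes "odd K" "even m" "m > 0"
  shows "3 dvd kfib_period K m"
proof -
  have "kfib_period K 2 dvd 3"
    using is_kfib_period_2_3[OF \<open>odd K\<close>] by (simp add: kfib_period_dvd_iff)
  then have "kfib_period K 2 = 3"
    using kfib_period_gt_1[of 2 K] prime_nat_iff[of 3] by auto
  then show ?thesis
    using kfib_period_dvd_mono[of 2 m K] assms by simp
qed

lemma not_is_kfib_period_3_4:
  assumes "\<not> 3 dvd K"
  shows "\<not> is_kfib_period K 3 4"
proof
  assume "is_kfib_period K 3 4"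
  then have "[kfib K (Suc 4) = 1] (mod 3)"
    unfolding is_kfib_period_iff by blast
  moreover have "kfib K (Suc 4) = (K ^ 4 + 3 * K\<^sup>2) + 1"
    by (simp add: eval_nat_numeral algebra_simps)
  ultimately have "[(K ^ 4 + 3 * K\<^sup>2) + 1 = 0 + 1] (mod 3)"
    by simp
  then have "3 dvd K ^ 4 + 3 * K\<^sup>2"
    unfolding cong_add_rcancel_nat cong_0_iff .
  then have "3 dvd K ^ 4"
    using dvd_add_left_iff[of 3 "3 * K\<^sup>2" "K ^ 4"] by simp
  then show False
    using assms prime_dvd_power[of 3 K 4] by simp
qed

lemma eight_dvd_kfib_period:
  assumes "\<not> 3 dvd K" "3 dvd m" "m > 0"
  shows "8 dvd kfib_period K m"
proof -
  have "is_kfib_period K 3 (2 ^ Suc 2)"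
    using is_kfib_period_prime_period_multiple[of 3 K] not_3_dvd_square_plus_4
    by (simp add: prime_period_multiple_def)
  moreover have "\<not> is_kfib_period K 3 (2 ^ 2)"
    using not_is_kfib_period_3_4[OF assms(1)] by simp
  ultimately have "kfib_period K 3 dvd 2 ^ Suc 2" "\<not> kfib_period K 3 dvd 2 ^ 2"
    by (simp_all only: kfib_period_dvd_iff zero_less_numeral not_False_eq_True)
  then have "kfib_period K 3 = 2 ^ Suc 2"
    by (rule prime_power_Suc_eq_of_dvd[OF two_is_prime_nat])
  then show ?thesis
    using kfib_period_dvd_mono[OF assms(2,3), of K] by simp
qed

lemma twentyfour_dvd_kfib_period:
  assumes "odd K" "\<not> 3 dvd K" "6 dvd m" "m > 0"
  shows "24 dvd kfib_period K m"
proof -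
  have "even m" "3 dvd m"
    using \<open>6 dvd m\<close> by presburger+
  then have "3 dvd kfib_period K m" "8 dvd kfib_period K m"
    using assms three_dvd_kfib_period eight_dvd_kfib_period by blast+
  then show ?thesis
    by presburger
qed

lemma funpow_kfib_period_gt_1: "m > 1 \<Longrightarrow> (kfib_period K ^^ n) m > 1"
  by (induction n) (simp_all add: kfib_period_gt_1 del: One_nat_def)

lemma twentyfour_dvd_funpow_4_kfib_period:
  assumes "odd K" "\<not> 3 dvd K" "even m" "m > 0"
  shows "24 dvd (kfib_period K ^^ 4) m"
proof -
  let ?\<pi> = "kfib_period K"
  have pos: "?\<pi> m > 0" "?\<pi> (?\<pi> m) > 0" "?\<pi> (?\<pi> (?\<pi> m)) > 0"
    using \<open>m > 0\<close> by (simp_all add: kfib_period_pos)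
  have "3 dvd ?\<pi> m"
    using \<open>odd K\<close> \<open>even m\<close> \<open>m > 0\<close> by (rule three_dvd_kfib_period)
  with \<open>\<not> 3 dvd K\<close> have "8 dvd ?\<pi> (?\<pi> m)"
    using pos(1) by (rule eight_dvd_kfib_period)
  then have "even (?\<pi> (?\<pi> m))" "?\<pi> (?\<pi> m) > 2"
    using pos(2) by presburger+
  then have "3 dvd ?\<pi> (?\<pi> (?\<pi> m))" "even (?\<pi> (?\<pi> (?\<pi> m)))"
    using three_dvd_kfib_period[OF \<open>odd K\<close>] even_kfib_period pos(2) by simp_all
  then have "6 dvd ?\<pi> (?\<pi> (?\<pi> m))"
    by presburger
  then have "24 dvd ?\<pi> (?\<pi> (?\<pi> (?\<pi> m)))"
    using pos(3) by (rule twentyfour_dvd_kfib_period[OF assms(1,2)])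
  then show ?thesis
    by (simp add: eval_nat_numeral)
qed

lemma reaches_24_dvd:
  assumes "odd K" "\<not> 3 dvd K" "m > 1"
  shows "\<exists>n. 24 dvd (kfib_period K ^^ n) m"
proof (cases "even m")
  case True
  then show ?thesis
    using twentyfour_dvd_funpow_4_kfib_period assms by (intro exI[of _ 4]) simp
next
  case False
  then have "even (kfib_period K m)" "kfib_period K m > 0"
    using \<open>m > 1\<close> even_kfib_period[of m K] by (cases "m = 2", auto intro: kfib_period_pos)
  then have "24 dvd (kfib_period K ^^ Suc 4) m"
    unfolding funpow_Suc_right o_apply by (rule twentyfour_dvd_funpow_4_kfib_period[OF assms(1,2)])
  then show ?thesis ..
qed

section \<open>The eventual form of the iterates\<close>

lemma eventually_funpow:
  assumes "P ((f ^^ N) x)" "\<And>y. P y \<Longrightarrow> P (f y)"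
  shows "\<forall>\<^sub>F n in sequentially. P ((f ^^ n) x)"
  unfolding eventually_sequentially
proof (intro exI[of _ N] allI impI)
  fix n assume "N \<le> n"
  then show "P ((f ^^ n) x)"
    by (induction n rule: dec_induct) (use assms in simp_all)
qed

lemma eventually_no_excess_primes:
  assumes "m > 1"
  shows "\<forall>\<^sub>F n in sequentially. excess_primes K ((kfib_period K ^^ n) m) = {}"
proof -
  let ?P = "\<lambda>x. x > 1 \<and> excess_primes K x = {}"
  obtain N where "?P ((kfib_period K ^^ N) m)"
    using reaches_no_excess_primes funpow_kfib_period_gt_1 assms by blast
  then have "\<forall>\<^sub>F n in sequentially. ?P ((kfib_period K ^^ n) m)"
    by (rule eventually_funpow) (use kfib_period_gt_1 excess_primes_empty_kfib_period in blast)
  then show ?thesis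
    by (rule eventually_mono) blast
qed

lemma eventually_24_dvd:
  assumes "odd K" "\<not> 3 dvd K" "m > 1"
  shows "\<forall>\<^sub>F n in sequentially. 24 dvd (kfib_period K ^^ n) m"
proof -
  let ?P = "\<lambda>x. x > 0 \<and> 24 dvd x"
  obtain N where "?P ((kfib_period K ^^ N) m)"
    using reaches_24_dvd[OF assms] funpow_kfib_period_gt_1[OF \<open>m > 1\<close>] gr_implies_not0 by blast
  moreover have "?P (kfib_period K x)" if "?P x" for x
  proof -
    have "6 dvd x"
      using that by presburger
    then show ?thesis
      using that twentyfour_dvd_kfib_period[OF assms(1,2)] kfib_period_pos by blast
  qed
  ultimately have "\<forall>\<^sub>F n in sequentially. ?P ((kfib_period K ^^ n) m)"
    by (rule eventually_funpow)
  then show ?thesis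
    by (rule eventually_mono) blast
qed

lemma eq_24_mult_prod_ramified_primes:
  assumes "m > 0" "24 dvd m" "excess_primes K m = {}"
  shows "\<exists>j. m = 24 * (\<Prod>p\<in>prime_factors (K\<^sup>2 + 4). p ^ j p)"
proof -
  obtain c where c: "m = 24 * c"
    using \<open>24 dvd m\<close> by blast
  then have "c > 0"
    using \<open>m > 0\<close> by simp
  have "prime_factors c \<subseteq> prime_factors (K\<^sup>2 + 4)"
  proof
    fix p assume "p \<in> prime_factors c"
    then have "prime p" "multiplicity p c > 0"
      by (simp_all add: prime_factors_multiplicity)
    then have "multiplicity p 24 < multiplicity p m"
      using c \<open>c > 0\<close> by (simp add: prime_elem_multiplicity_mult_distrib)
    then show "p \<in> prime_factors (K\<^sup>2 + 4)"
      using assms(3) \<open>prime p\<close> by (auto simp: excess_primes_def in_prime_factors_iff)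
  qed
  then have "(\<Prod>p\<in>prime_factors (K\<^sup>2 + 4). p ^ multiplicity p c) = normalize c"
    using \<open>c > 0\<close> by (intro prod_multiplicity_superset) auto
  then show ?thesis
    using c by (intro exI[of _ "\<lambda>p. multiplicity p c"]) simp
qed

theorem theorem4p5:
  fixes K m :: nat
  assumes "K \<ge> 1"
    and "[int K = 1] (mod 6) \<or> [int K = - 1] (mod 6)"
    and "m > 1"
  shows "\<exists>N\<ge>1. \<forall>n\<ge>N. \<exists>j :: nat \<Rightarrow> nat.
    (kfib_period K ^^ n) m = 24 * (\<Prod>p\<in>prime_factors (K\<^sup>2 + 4). p ^ j p)"
proof -
  have "int K mod 6 = 1 \<or> int K mod 6 = 5"
    using assms(2) by (simp add: cong_def)
  then have "odd K" "\<not> 3 dvd K"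
    by presburger+
  then have "\<forall>\<^sub>F n in sequentially. 24 dvd (kfib_period K ^^ n) m"
    using \<open>m > 1\<close> by (rule eventually_24_dvd)
  moreover have "\<forall>\<^sub>F n in sequentially. excess_primes K ((kfib_period K ^^ n) m) = {}"
    using \<open>m > 1\<close> by (rule eventually_no_excess_primes)
  ultimately have "\<forall>\<^sub>F n in sequentially. n \<ge> 1 \<and> (\<exists>j. (kfib_period K ^^ n) m =
      24 * (\<Prod>p\<in>prime_factors (K\<^sup>2 + 4). p ^ j p))"
    using eventually_ge_at_top[of 1]
  proof eventually_elim
    case (elim n)
    then show ?case
      using eq_24_mult_prod_ramified_primes funpow_kfib_period_gt_1[OF \<open>m > 1\<close>, of n K] by simp
  qed
  then show ?thesis
    unfolding eventually_sequentially by blast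
qed

end
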